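(* Let $\mathbb{X}\subset\mathbb{R}^n$, let $Y$ be a nonempty subset of a Banach space $\mathbb{Y}$, let $T\subset\mathbb{R}^l$ be nonempty and convex, and let $\phi:\mathbb{X}\times Y\times T\to\mathbb{R}$ and $\psi_i:\mathbb{X}\times Y\times T\to\mathbb{R}$, $i=1,\dots,m$, be continuous. Consider the parametric problem $$\min_{x\in\mathbb{X}}\ \phi(x,y,t)\quad\text{s.t.}\quad\psi_i(x,y,t)\le0,\ i=1,\dots,m,$$ with feasible set $X(y,t)$, optimal value $\phi^*(y,t)$ and optimal solution set $X^*(y,t)$; put $\psi=(\psi_1,\dots,\psi_m)^T$. Assume: (a) for each $(y,t)\in Y\times T$, $X(y,t)\subset\mathbb{R}^n$ is a compact and convex set, and there exist a constant $A>0$ and a compact set $\hat X$ such that $\mathrm{diam}(X(y,t))\le A$ for all $(y,t)$ and $\bigcup_{y\in Y,t\in T}X(y,t)\subset\hat X$; (b) there is a constant $\alpha>0$ such that for every $(y,t)\in Y\times T$ there exists $\bar x(y,t)\in X(y,t)$ with $\psi_i(\bar x(y,t),y,t)\le-\alpha$ for $i=1,\dots,m$; (c) for each fixed $(y,t)$, $\psi_i(x,y,t)$ is convex in $x$ for $i=1,\dots,m$; (d) there are constants $\kappa_\psi>0$, $q_\psi\in(0,1]$ such that $\|\psi(x,y,t')-\psi(x,y,t'')\|\le\kappa_\psi\|t'-t''\|^{q_\psi}$ for all $t',t''\in T$ and all $(x,y)\in\hat X\times Y$; (e) there are constants $\kappa_\phi>0$ and $q_1,q_2\in(0,1]$ such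 that for all $y\in Y$, $$|\phi(x',y,t')-\phi(x'',y,t'')|\le\kappa_\phi(\|x'-x''\|^{q_1}+\|t'-t''\|^{q_2}),\quad\forall x',x''\in\hat X,\ t',t''\in T.$$ Then the following hold. (i) If, in addition, (f) $\phi(x,y,t)$ is strictly quasi-convex in $x$, then $X^*(y,t)$ is a singleton $\{x^*(y,t)\}$ for each $(y,t)$, and the optimal value function $\phi^*(y,t)$ and the optimal solution mapping $x^*(y,t)$ are continuous in $t\in T$. (ii) If, in addition, (f') there exist positive constants $\nu,\beta$ such that for all $(y,t)\in Y\times T$, $$\phi(x,y,t)\ge\phi^*(y,t)+\beta\,d(x,X^*(y,t))^\nu,\quad\forall x\in X(y,t),$$ then, with $q:=\min\{q_1q_\psi,q_2\}$, for all $y\in Y$ and all $t',t''\in T$ with $\|t'-t''\|\le1$, $$\mathbb{H}(X^*(y,t'),X^*(y,t''))\le\frac{A\kappa_\psi}{\alpha}\|t''-t'\|^{q_\psi}+\left(\frac{4\kappa_\phi}{\beta}\left(\left(\frac{A\kappa_\psi}{\alpha}\right)^{q_1}+1\right)\right)^{1/\nu}\|t'-t''\|^{q/\nu}$$ $$\le\left(\frac{A\kappa_\psi}{\alpha}+\left(\frac{4\kappa_\phi}{\beta}\left(\left(\frac{A\kappa_\psi}{\alpha}\right)^{q_1}+1\right)\right)^{1/\nu}\right)\|t'-t''\|^{\min\{q_\psi,\,q/\nu\}}.$$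
   Context: $\|\cdot\|$ is the Euclidean norm on finite-dimensional spaces; $d(x,S)=\inf_{s\in S}\|x-s\|$; $\mathrm{diam}(S)=\sup_{s,s'\in S}\|s-s'\|$; $\mathbb{H}(S_1,S_2)=\max\{\sup_{s\in S_1}d(s,S_2),\sup_{s\in S_2}d(s,S_1)\}$ is the Hausdorff distance. The feasible set is $X(y,t)=\{x\in\mathbb{X}:\psi_i(x,y,t)\le0,\ i=1,\dots,m\}$. *)

theory Defs
  imports "HOL-Analysis.Analysis"
begin

text \<open>The vector-valued constraint map \<open>\<psi>\<close> has the components \<open>\<psi>\<^sub>i(x,y,t) = \<psi> x y t $ i\<close>,
  so that \<open>norm\<close> on \<open>real ^ 'm\<close> is the Euclidean norm of \<open>\<psi>\<close>.\<close>

definition feasible_set ::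
  "(real^'n) set \<Rightarrow> (real^'n \<Rightarrow> 'y \<Rightarrow> 't \<Rightarrow> real^'m) \<Rightarrow> 'y \<Rightarrow> 't \<Rightarrow> (real^'n) set" where
  "feasible_set D \<psi> y t = {x \<in> D. \<forall>i. \<psi> x y t $ i \<le> 0}"

definition opt_value ::
  "(real^'n) set \<Rightarrow> (real^'n \<Rightarrow> 'y \<Rightarrow> 't \<Rightarrow> real) \<Rightarrow> (real^'n \<Rightarrow> 'y \<Rightarrow> 't \<Rightarrow> real^'m)
    \<Rightarrow> 'y \<Rightarrow> 't \<Rightarrow> real" where
  "opt_value D \<phi> \<psi> y t = (INF x\<in>feasible_set D \<psi> y t. \<phi> x y t)"

definition opt_solutions ::
  "(real^'n) set \<Rightarrow> (real^'n \<Rightarrow> 'y \<Rightarrow> 't \<Rightarrow> real) \<Rightarrow> (real^'n \<Rightarrow> 'y \<Rightarrow> 't \<Rightarrow> real^'m)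
    \<Rightarrow> 'y \<Rightarrow> 't \<Rightarrow> (real^'n) set" where
  "opt_solutions D \<phi> \<psi> y t =
     {x \<in> feasible_set D \<psi> y t. \<forall>z\<in>feasible_set D \<psi> y t. \<phi> x y t \<le> \<phi> z y t}"

text \<open>As the supremum and the distance are real-valued, this is the Hausdorff distance only for
  nonempty bounded sets.\<close>

definition hausdorff_distance :: "'a::metric_space set \<Rightarrow> 'a set \<Rightarrow> real" where
  "hausdorff_distance S1 S2 = max (SUP s\<in>S1. infdist s S2) (SUP s\<in>S2. infdist s S1)"

text \<open>Like \<^const>\<open>convex_on\<close>, this includes convexity of the domain. The inequality is strict for
  all pairs of distinct points, also for those with equal values; this is the notion of strict
  quasi-convexity under which minimizers are unique.\<close>

definition strictly_quasiconvex_on :: "'a::real_vector set \<Rightarrow> ('a \<Rightarrow> real) \<Rightarrow> bool" where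
  "strictly_quasiconvex_on S f \<longleftrightarrow> convex S \<and>
     (\<forall>x\<in>S. \<forall>y\<in>S. \<forall>u>0. \<forall>v>0. x \<noteq> y \<longrightarrow> u + v = 1 \<longrightarrow>
        f (u *\<^sub>R x + v *\<^sub>R y) < max (f x) (f y))"

end

theory Submission
  imports Defs
begin

text \<open>Moving a point that violates the constraints by at most \<open>\<delta>\<close> towards a Slater point yields a
  feasible point at distance at most \<open>A * \<delta> / \<alpha>\<close>, so the feasible sets for \<open>t'\<close> and \<open>t''\<close> are at
  Hausdorff distance at most \<open>C * \<parallel>t' - t''\<parallel> powr q\<^sub>\<psi>\<close>. By the Hoelder estimate (e),
  the optimal values then differ by at most a quantity \<open>E\<close> that tends to 0, and every solution for \<open>t'\<close> is close to
  a feasible, \<open>2 * E\<close>-optimal point for \<open>t''\<close>. Such a point is close to the solution set for \<open>t''\<close>: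
  by compactness and uniqueness in (i), by the growth condition in (ii).\<close>

text \<open>On the segment from \<open>x\<close> to \<open>z\<close>, convexity bounds every
  \<open>f i\<close> by the affine interpolation between \<open>\<delta>\<close> and
  \<open>- \<alpha>\<close>, so the zero of that interpolation gives one point that is feasible for
  all \<open>i\<close> at once.\<close>

lemma slater_error_bound:
  fixes f :: "'i \<Rightarrow> 'a::real_normed_vector \<Rightarrow> real"
  assumes conv: "\<And>i. convex_on D (f i)"
    and "x \<in> D" "0 \<le> \<delta>" and x: "\<And>i. f i x \<le> \<delta>"
    and "z \<in> D" "0 < \<alpha>" and z: "\<And>i. f i z \<le> - \<alpha>"
    and A: "\<And>w. w \<in> D \<Longrightarrow> \<forall>i. f i w \<le> 0 \<Longrightarrow> dist w z \<le> A"
  obtains w where "w \<in> D" "\<forall>i. f i w \<le> 0" "dist x w \<le> A * \<delta> / \<alpha>"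
proof -
  \<comment> \<open>The weight solves \<open>(1 - u) * \<delta> - u * \<alpha> = 0\<close>.\<close>
  define u where "u = \<delta> / (\<alpha> + \<delta>)"
  define w where "w = (1 - u) *\<^sub>R x + u *\<^sub>R z"
  have u: "0 \<le> u" "u \<le> 1" "1 - u = \<alpha> / (\<alpha> + \<delta>)"
    using \<open>0 < \<alpha>\<close> \<open>0 \<le> \<delta>\<close> by (auto simp: u_def field_simps)
  have "convex D"
    using conv convex_on_imp_convex by blast
  hence wD: "w \<in> D"
    unfolding w_def using u \<open>x \<in> D\<close> \<open>z \<in> D\<close> by (intro convexD) auto
  have fw: "f i w \<le> 0" for i
  proof -
    have "f i w \<le> (1 - u) * f i x + u * f i z"
      unfolding w_def using conv u \<open>x \<in> D\<close> \<open>z \<in> D\<close> by (intro convex_onD) auto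
    also have "\<dots> \<le> (1 - u) * \<delta> + u * (- \<alpha>)"
      using u x z by (intro add_mono mult_left_mono) auto
    also have "\<dots> = 0"
      unfolding u(3) by (simp add: u_def)
    finally show ?thesis .
  qed
  \<comment> \<open>Only \<open>dist w z\<close> is bounded by \<open>A\<close>, as \<open>x\<close> and \<open>z\<close> need not be feasible for the same parameter.\<close>
  have xw: "x - w = u *\<^sub>R (x - z)" and wz: "w - z = (1 - u) *\<^sub>R (x - z)"
    by (simp_all add: w_def algebra_simps)
  \<comment> \<open>\<open>w\<close> divides the segment from \<open>x\<close> to \<open>z\<close>
    in the ratio \<open>\<delta>\<close> to \<open>\<alpha>\<close>.\<close>
  have "dist x w = \<delta> / \<alpha> * dist w z"
    unfolding dist_norm xw wz norm_scaleR u(3) using \<open>0 < \<alpha>\<close> \<open>0 \<le> \<delta>\<close> by (simp add: u_def)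
  also have "\<dots> \<le> \<delta> / \<alpha> * A"
    using A[OF wD] fw \<open>0 < \<alpha>\<close> \<open>0 \<le> \<delta>\<close> by (intro mult_left_mono) auto
  finally show ?thesis
    using that wD fw by (simp add: mult.commute)
qed

text \<open>Outside the ball around \<open>a\<close>, compactness gives a minimum of
  \<open>f\<close>, and it lies strictly above \<open>f a\<close>; this gap serves as
  \<open>\<eta>\<close>. The lemma turns almost optimal values into closeness to the
  minimizer.\<close>

lemma unique_minimizer_well_posed:
  fixes f :: "'a::metric_space \<Rightarrow> real"
  assumes "compact S" "continuous_on S f" "0 < \<epsilon>"
    and min: "\<And>x. x \<in> S \<Longrightarrow> x \<noteq> a \<Longrightarrow> f a < f x"
  obtains \<eta> where "0 < \<eta>" "\<And>x. x \<in> S \<Longrightarrow> f x < f a + \<eta> \<Longrightarrow> dist x a < \<epsilon>"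
proof (cases "S - ball a \<epsilon> = {}")
  case True
  then show ?thesis
    by (intro that[of 1]) (auto simp: dist_commute)
next
  case False
  moreover have "compact (S - ball a \<epsilon>)"
    using \<open>compact S\<close> by (simp add: compact_diff)
  moreover have "continuous_on (S - ball a \<epsilon>) f"
    using \<open>continuous_on S f\<close> by (rule continuous_on_subset) auto
  ultimately obtain b where b: "b \<in> S - ball a \<epsilon>" "\<And>x. x \<in> S - ball a \<epsilon> \<Longrightarrow> f b \<le> f x"
    using continuous_attains_inf[of "S - ball a \<epsilon>" f] by metis
  have "f a < f b"
    using b \<open>0 < \<epsilon>\<close> by (intro min) auto
  show ?thesis
  proof (rule that[of "f b - f a"])
    show "0 < f b - f a"
      using \<open>f a < f b\<close> by simp
    show "dist x a < \<epsilon>" if "x \<in> S" "f x < f a + (f b - f a)" for x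
      using b(2)[of x] that by (force simp: dist_commute)
  qed
qed

lemma opt_value_eq:
  assumes "x \<in> opt_solutions D \<phi> \<psi> y t"
  shows "opt_value D \<phi> \<psi> y t = \<phi> x y t"
  unfolding opt_value_def using assms
  by (intro cInf_eq_minimum) (auto simp: opt_solutions_def)

lemma opt_solutions_nonempty:
  assumes "compact (feasible_set D \<psi> y t)" "feasible_set D \<psi> y t \<noteq> {}"
    and "continuous_on (feasible_set D \<psi> y t) (\<lambda>x. \<phi> x y t)"
  shows "opt_solutions D \<phi> \<psi> y t \<noteq> {}"
  using continuous_attains_inf[OF assms] by (auto simp: opt_solutions_def)

text \<open>The midpoint of two distinct minimizers would lie in \<open>S\<close> and have a
  strictly smaller value. In the application, \<open>S\<close> is the feasible set and
  \<open>D\<close> the domain of the objective.\<close>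

lemma strictly_quasiconvex_unique_minimizer:
  assumes f: "strictly_quasiconvex_on D f" and "convex S" "S \<subseteq> D"
    and "x \<in> S" "\<And>w. w \<in> S \<Longrightarrow> f x \<le> f w" "z \<in> S" "\<And>w. w \<in> S \<Longrightarrow> f z \<le> f w"
  shows "x = z"
proof (rule ccontr)
  assume "x \<noteq> z"
  let ?m = "(1/2) *\<^sub>R x + (1/2) *\<^sub>R z"
  have half: "(1/2::real) > 0" "(1/2::real) + 1/2 = 1"
    by simp_all
  have "f ?m < max (f x) (f z)"
    using f \<open>x \<noteq> z\<close> \<open>x \<in> S\<close> \<open>z \<in> S\<close> \<open>S \<subseteq> D\<close> half unfolding strictly_quasiconvex_on_def by blast
  moreover have "?m \<in> S"
    using \<open>convex S\<close> \<open>x \<in> S\<close> \<open>z \<in> S\<close> by (intro convexD) auto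
  ultimately show False
    using assms(5)[of ?m] assms(7)[of ?m] by linarith
qed

text \<open>A pointwise bound passes to the real-valued suprema because both index sets are
  nonempty.\<close>

lemma hausdorff_distance_le:
  assumes "S1 \<noteq> {}" "S2 \<noteq> {}"
    and "\<And>s. s \<in> S1 \<Longrightarrow> infdist s S2 \<le> r" "\<And>s. s \<in> S2 \<Longrightarrow> infdist s S1 \<le> r"
  shows "hausdorff_distance S1 S2 \<le> r"
  unfolding hausdorff_distance_def using assms by (simp add: cSUP_least)

theorem theorem3p1:
  fixes D Xhat :: "(real^'n) set"
    and Y :: "'y::banach set"
    and T :: "(real^'l) set"
    and \<phi> :: "real^'n \<Rightarrow> 'y \<Rightarrow> real^'l \<Rightarrow> real"
    and \<psi> :: "real^'n \<Rightarrow> 'y \<Rightarrow> real^'l \<Rightarrow> real^'m"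
    and A \<alpha> \<kappa>\<^sub>\<psi> q\<^sub>\<psi> \<kappa>\<^sub>\<phi> q\<^sub>1 q\<^sub>2 :: real
  assumes Y_ne: "Y \<noteq> {}"
    and T_ne: "T \<noteq> {}"
    and T_convex: "convex T"
    and \<phi>_cont: "continuous_on (D \<times> Y \<times> T) (\<lambda>(x, y, t). \<phi> x y t)"
    and \<psi>_cont: "\<And>i. continuous_on (D \<times> Y \<times> T) (\<lambda>(x, y, t). \<psi> x y t $ i)"
    and a_compact: "\<And>y t. y \<in> Y \<Longrightarrow> t \<in> T \<Longrightarrow> compact (feasible_set D \<psi> y t)"
    and a_convex: "\<And>y t. y \<in> Y \<Longrightarrow> t \<in> T \<Longrightarrow> convex (feasible_set D \<psi> y t)"
    and a_A: "A > 0"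
    and a_diam: "\<And>y t. y \<in> Y \<Longrightarrow> t \<in> T \<Longrightarrow> diameter (feasible_set D \<psi> y t) \<le> A"
    and a_Xhat: "compact Xhat"
    and a_union: "(\<Union>y\<in>Y. \<Union>t\<in>T. feasible_set D \<psi> y t) \<subseteq> Xhat"
    and b_\<alpha>: "\<alpha> > 0"
    and b_slater: "\<And>y t. y \<in> Y \<Longrightarrow> t \<in> T \<Longrightarrow>
            \<exists>x\<in>feasible_set D \<psi> y t. \<forall>i. \<psi> x y t $ i \<le> - \<alpha>"
    and c: "\<And>y t i. y \<in> Y \<Longrightarrow> t \<in> T \<Longrightarrow> convex_on D (\<lambda>x. \<psi> x y t $ i)"
    and d_consts: "\<kappa>\<^sub>\<psi> > 0" "0 < q\<^sub>\<psi>" "q\<^sub>\<psi> \<le> 1"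
    and d: "\<And>x y t' t''. x \<in> Xhat \<inter> D \<Longrightarrow> y \<in> Y \<Longrightarrow> t' \<in> T \<Longrightarrow> t'' \<in> T \<Longrightarrow>
            norm (\<psi> x y t' - \<psi> x y t'') \<le> \<kappa>\<^sub>\<psi> * norm (t' - t'') powr q\<^sub>\<psi>"
    and e_consts: "\<kappa>\<^sub>\<phi> > 0" "0 < q\<^sub>1" "q\<^sub>1 \<le> 1" "0 < q\<^sub>2" "q\<^sub>2 \<le> 1"
    and e: "\<And>y x' x'' t' t''. y \<in> Y \<Longrightarrow> x' \<in> Xhat \<inter> D \<Longrightarrow> x'' \<in> Xhat \<inter> D \<Longrightarrow>
            t' \<in> T \<Longrightarrow> t'' \<in> T \<Longrightarrow>
            \<bar>\<phi> x' y t' - \<phi> x'' y t''\<bar>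
              \<le> \<kappa>\<^sub>\<phi> * (norm (x' - x'') powr q\<^sub>1 + norm (t' - t'') powr q\<^sub>2)"
  shows
    "((\<forall>y\<in>Y. \<forall>t\<in>T. strictly_quasiconvex_on D (\<lambda>x. \<phi> x y t)) \<longrightarrow>
        (\<exists>xstar. (\<forall>y\<in>Y. \<forall>t\<in>T. opt_solutions D \<phi> \<psi> y t = {xstar y t}) \<and>
           (\<forall>y\<in>Y. continuous_on T (\<lambda>t. opt_value D \<phi> \<psi> y t)) \<and>
           (\<forall>y\<in>Y. continuous_on T (\<lambda>t. xstar y t))))
     \<and>
     (\<forall>\<nu>>0. \<forall>\<beta>>0.
        (\<forall>y\<in>Y. \<forall>t\<in>T. \<forall>x\<in>feasible_set D \<psi> y t.
            \<phi> x y t \<ge> opt_value D \<phi> \<psi> y t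
                        + \<beta> * infdist x (opt_solutions D \<phi> \<psi> y t) powr \<nu>) \<longrightarrow>
        (let q = min (q\<^sub>1 * q\<^sub>\<psi>) q\<^sub>2;
             C = A * \<kappa>\<^sub>\<psi> / \<alpha>;
             K = (4 * \<kappa>\<^sub>\<phi> / \<beta> * (C powr q\<^sub>1 + 1)) powr (1 / \<nu>)
         in \<forall>y\<in>Y. \<forall>t'\<in>T. \<forall>t''\<in>T. norm (t' - t'') \<le> 1 \<longrightarrow>
              hausdorff_distance (opt_solutions D \<phi> \<psi> y t') (opt_solutions D \<phi> \<psi> y t'')
                \<le> C * norm (t'' - t') powr q\<^sub>\<psi> + K * norm (t' - t'') powr (q / \<nu>)
              \<and> C * norm (t'' - t') powr q\<^sub>\<psi> + K * norm (t' - t'') powr (q / \<nu>)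
                \<le> (C + K) * norm (t' - t'') powr (min q\<^sub>\<psi> (q / \<nu>))))"
proof -

  \<comment> \<open>Constants and solvability\<close>
  let ?F = "feasible_set D \<psi>" and ?O = "opt_solutions D \<phi> \<psi>" and ?v = "opt_value D \<phi> \<psi>"
  \<comment> \<open>When the parameter moves by \<open>r\<close>, a feasible point has to move by at
    most \<open>C * r powr q\<^sub>\<psi>\<close>; \<open>E r\<close> is the change of the objective
    that (e) then permits.\<close>
  define C where "C = A * \<kappa>\<^sub>\<psi> / \<alpha>"
  define E where "E = (\<lambda>r. \<kappa>\<^sub>\<phi> * (C powr q\<^sub>1 * r powr (q\<^sub>1 * q\<^sub>\<psi>) + r powr q\<^sub>2))"
  have C0: "C > 0"
    using a_A d_consts b_\<alpha> by (simp add: C_def)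
  \<comment> \<open>The functions are total in the formalization, so (d) and (e) are available on
    \<open>Xhat \<inter> D\<close> only.\<close>
  have FX: "?F y t \<subseteq> Xhat \<inter> D" if "y \<in> Y" "t \<in> T" for y t
    using a_union that by (auto simp: feasible_set_def)
  have OF: "?O y t \<subseteq> ?F y t" for y t
    by (auto simp: opt_solutions_def)
  have cont: "continuous_on (?F y t) (\<lambda>x. \<phi> x y t)" if "y \<in> Y" "t \<in> T" for y t
  proof -
    have "continuous_on (?F y t) (\<lambda>x. (\<lambda>(x, y, t). \<phi> x y t) (x, y, t))"
      by (rule continuous_on_compose2[OF \<phi>_cont])
        (use that FX[OF that] in \<open>auto intro!: continuous_intros\<close>)
    then show ?thesis
      by simp
  qed
  have O_ne: "?O y t \<noteq> {}" if "y \<in> Y" "t \<in> T" for y t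
    using that a_compact cont b_slater by (intro opt_solutions_nonempty) blast+

  \<comment> \<open>Perturbation of feasible points, optimal values and solutions\<close>
  have near: "\<exists>w\<in>?F y t''. dist x w \<le> C * norm (t' - t'') powr q\<^sub>\<psi> \<and>
                \<phi> w y t'' \<le> \<phi> x y t' + E (norm (t' - t''))"
    if y: "y \<in> Y" and t: "t' \<in> T" "t'' \<in> T" and x: "x \<in> ?F y t'" for y t' t'' x
  proof -
    let ?r = "norm (t' - t'')"
    \<comment> \<open>The Slater point belongs to the target parameter \<open>t''\<close>, whereas
      \<open>x\<close> is feasible for \<open>t'\<close>.\<close>
    obtain z where z: "z \<in> ?F y t''" "\<And>i. \<psi> z y t'' $ i \<le> - \<alpha>"
      using b_slater y t by blast
    have xX: "x \<in> Xhat \<inter> D"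
      using FX y t x by blast
    have violation: "\<psi> x y t'' $ i \<le> \<kappa>\<^sub>\<psi> * ?r powr q\<^sub>\<psi>" for i
    proof -
      have "\<bar>(\<psi> x y t' - \<psi> x y t'') $ i\<bar> \<le> \<kappa>\<^sub>\<psi> * ?r powr q\<^sub>\<psi>"
        using component_le_norm_cart d[OF xX y t] by (rule order_trans)
      moreover have "\<psi> x y t' $ i \<le> 0"
        using x by (simp add: feasible_set_def)
      ultimately show ?thesis
        by simp
    qed
    \<comment> \<open>Both points are feasible for \<open>t''\<close>, so the diameter bound in (a)
      applies; compactness makes \<open>diameter\<close> an actual bound on distances.\<close>
    have diam: "dist w z \<le> A" if "w \<in> D" "\<forall>i. \<psi> w y t'' $ i \<le> 0" for w
    proof -
      have "w \<in> ?F y t''"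
        using that by (simp add: feasible_set_def)
      then have "dist w z \<le> diameter (?F y t'')"
        using z(1) a_compact[OF y t(2)] by (intro diameter_bounded_bound compact_imp_bounded)
      then show ?thesis
        using a_diam[OF y t(2)] by linarith
    qed
    have "0 \<le> \<kappa>\<^sub>\<psi> * ?r powr q\<^sub>\<psi>" "z \<in> D" "x \<in> D"
      using d_consts z(1) xX by (auto simp: feasible_set_def)
    then obtain w where w: "w \<in> D" "\<forall>i. \<psi> w y t'' $ i \<le> 0"
        "dist x w \<le> A * (\<kappa>\<^sub>\<psi> * ?r powr q\<^sub>\<psi>) / \<alpha>"
      using slater_error_bound[of D "\<lambda>i x. \<psi> x y t'' $ i" x "\<kappa>\<^sub>\<psi> * ?r powr q\<^sub>\<psi>" z \<alpha> A]
        c[OF y t(2)] violation diam b_\<alpha> z(2) by blast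
    have wF: "w \<in> ?F y t''"
      using w by (simp add: feasible_set_def)
    have xw: "dist x w \<le> C * ?r powr q\<^sub>\<psi>"
      using w(3) by (simp add: C_def)
    have "\<bar>\<phi> w y t'' - \<phi> x y t'\<bar> \<le> \<kappa>\<^sub>\<phi> * (norm (w - x) powr q\<^sub>1 + norm (t'' - t') powr q\<^sub>2)"
      using e y t xX FX wF by blast
    also have "\<dots> = \<kappa>\<^sub>\<phi> * (dist x w powr q\<^sub>1 + ?r powr q\<^sub>2)"
      by (simp add: dist_norm norm_minus_commute)
    also have "\<dots> \<le> \<kappa>\<^sub>\<phi> * ((C * ?r powr q\<^sub>\<psi>) powr q\<^sub>1 + ?r powr q\<^sub>2)"
      using xw e_consts by (intro mult_left_mono add_right_mono powr_mono2) auto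
    also have "\<dots> = E ?r"
      using C0 by (simp add: E_def powr_mult powr_powr mult.commute)
    finally show ?thesis
      using wF xw by (intro bexI[of _ w]) auto
  qed

  \<comment> \<open>A minimizer for \<open>t'\<close> is moved to a point feasible for
    \<open>t''\<close>, which cannot beat the minimum there. Exchanging \<open>t'\<close> and
    \<open>t''\<close> gives the reverse estimate.\<close>
  have value_le: "?v y t'' \<le> ?v y t' + E (norm (t' - t''))"
    if y: "y \<in> Y" and t: "t' \<in> T" "t'' \<in> T" for y t' t''
  proof -
    obtain x x'' where x: "x \<in> ?O y t'" "x'' \<in> ?O y t''"
      using O_ne y t by blast
    obtain w where "w \<in> ?F y t''" "\<phi> w y t'' \<le> \<phi> x y t' + E (norm (t' - t''))"
      using near[OF y t] x OF by blast
    moreover from this have "\<phi> x'' y t'' \<le> \<phi> w y t''"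
      using x by (simp add: opt_solutions_def)
    ultimately show ?thesis
      using x by (simp add: opt_value_eq)
  qed

  \<comment> \<open>One \<open>E\<close> is the cost of moving \<open>x\<close>, the other comes
    from comparing the two optimal values.\<close>
  have near_opt: "\<exists>w\<in>?F y t''. dist x w \<le> C * norm (t' - t'') powr q\<^sub>\<psi> \<and>
                    \<phi> w y t'' \<le> ?v y t'' + 2 * E (norm (t' - t''))"
    if y: "y \<in> Y" and t: "t' \<in> T" "t'' \<in> T" and x: "x \<in> ?O y t'" for y t' t'' x
  proof -
    have "?v y t' \<le> ?v y t'' + E (norm (t' - t''))"
      using value_le[OF y t(2,1)] by (simp add: norm_minus_commute)
    then show ?thesis
      using near[OF y t, of x] x OF opt_value_eq[OF x] by force
  qed

  \<comment> \<open>Vanishing of the error terms\<close>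
  have tendsto_r: "((\<lambda>t. norm (t - t0)) \<longlongrightarrow> 0) (at t0 within T)" for t0
    by (auto intro!: tendsto_eq_intros)
  \<comment> \<open>The base tends to 0, so a positive exponent is essential for the limit
    0.\<close>
  have tendsto_r_powr: "((\<lambda>t. norm (t - t0) powr p) \<longlongrightarrow> 0) (at t0 within T)" if "p > 0" for t0 p
    using tendsto_powr'[OF tendsto_r tendsto_const[of p]] that by simp
  have E_tendsto: "((\<lambda>t. E (norm (t - t0))) \<longlongrightarrow> 0) (at t0 within T)" for t0
  proof -
    have "((\<lambda>t. E (norm (t - t0))) \<longlongrightarrow> \<kappa>\<^sub>\<phi> * (C powr q\<^sub>1 * 0 + 0)) (at t0 within T)"
      unfolding E_def using d_consts e_consts
      by (intro tendsto_mult tendsto_add tendsto_const tendsto_r_powr) auto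
    then show ?thesis
      by simp
  qed

  \<comment> \<open>Part (i): uniqueness and continuity\<close>
  have part1: "\<exists>xstar. (\<forall>y\<in>Y. \<forall>t\<in>T. ?O y t = {xstar y t}) \<and>
      (\<forall>y\<in>Y. continuous_on T (\<lambda>t. ?v y t)) \<and> (\<forall>y\<in>Y. continuous_on T (\<lambda>t. xstar y t))"
    if qc: "\<forall>y\<in>Y. \<forall>t\<in>T. strictly_quasiconvex_on D (\<lambda>x. \<phi> x y t)"
  proof -
    define xstar where "xstar = (\<lambda>y t. SOME x. x \<in> ?O y t)"
    have xstar: "xstar y t \<in> ?O y t" if "y \<in> Y" "t \<in> T" for y t
      unfolding xstar_def using O_ne[OF that] by (simp add: some_in_eq)
    have unique: "x = xstar y t" if "y \<in> Y" "t \<in> T" "x \<in> ?O y t" for x y t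
    proof (rule strictly_quasiconvex_unique_minimizer)
      show "strictly_quasiconvex_on D (\<lambda>x. \<phi> x y t)" "convex (?F y t)" "?F y t \<subseteq> D"
        using qc a_convex FX that by blast+
    qed (use that xstar[OF that(1,2)] in \<open>auto simp: opt_solutions_def\<close>)
    have cont_v: "continuous_on T (\<lambda>t. ?v y t)" if y: "y \<in> Y" for y
      unfolding continuous_on_def
    proof
      fix t0 assume t0: "t0 \<in> T"
      have "\<bar>?v y t - ?v y t0\<bar> \<le> E (norm (t - t0))" if "t \<in> T" for t
        using value_le[OF y t0 that] value_le[OF y that t0] by (simp add: norm_minus_commute abs_le_iff)
      then have "\<forall>\<^sub>F t in at t0 within T. norm (?v y t - ?v y t0) \<le> E (norm (t - t0))"
        by (simp add: eventually_at_topological) blast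
      then have "((\<lambda>t. ?v y t - ?v y t0) \<longlongrightarrow> 0) (at t0 within T)"
        using E_tendsto by (rule Lim_null_comparison)
      then show "((\<lambda>t. ?v y t) \<longlongrightarrow> ?v y t0) (at t0 within T)"
        by (rule LIM_zero_cancel)
    qed
    have cont_x: "continuous_on T (\<lambda>t. xstar y t)" if y: "y \<in> Y" for y
      unfolding continuous_on_def
    proof (intro ballI tendstoI)
      fix t0 and \<epsilon> :: real assume t0: "t0 \<in> T" and "0 < \<epsilon>"
      let ?a = "xstar y t0"
      \<comment> \<open>A feasible point with a value no larger than that of \<open>?a\<close> would
        be a second solution.\<close>
      have "\<phi> ?a y t0 < \<phi> x y t0" if x: "x \<in> ?F y t0" "x \<noteq> ?a" for x
      proof (rule ccontr)
        assume "\<not> ?thesis"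
        then have "x \<in> ?O y t0"
          using xstar[OF y t0] x(1) by (force simp: opt_solutions_def)
        then show False
          using unique y t0 x(2) by blast
      qed
      then obtain \<eta> where \<eta>: "0 < \<eta>"
          "\<And>x. x \<in> ?F y t0 \<Longrightarrow> \<phi> x y t0 < \<phi> ?a y t0 + \<eta> \<Longrightarrow> dist x ?a < \<epsilon> / 2"
        using unique_minimizer_well_posed[OF a_compact[OF y t0] cont[OF y t0], of "\<epsilon> / 2" ?a]
          \<open>0 < \<epsilon>\<close> by auto
      have "((\<lambda>t. 2 * E (norm (t - t0))) \<longlongrightarrow> 0) (at t0 within T)"
        "((\<lambda>t. C * norm (t - t0) powr q\<^sub>\<psi>) \<longlongrightarrow> 0) (at t0 within T)"
        using d_consts by (auto intro!: tendsto_mult_right_zero E_tendsto tendsto_r_powr)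
      then have "\<forall>\<^sub>F t in at t0 within T. 2 * E (norm (t - t0)) < \<eta>"
        "\<forall>\<^sub>F t in at t0 within T. C * norm (t - t0) powr q\<^sub>\<psi> < \<epsilon> / 2"
        using \<open>0 < \<eta>\<close> \<open>0 < \<epsilon>\<close> order_tendstoD(2) half_gt_zero by blast+
      moreover have "\<forall>\<^sub>F t in at t0 within T. t \<in> T"
        by (simp add: eventually_at_filter)
      ultimately show "\<forall>\<^sub>F t in at t0 within T. dist (xstar y t) ?a < \<epsilon>"
      proof eventually_elim
        case (elim t)
        \<comment> \<open>The solution for \<open>t\<close> is moved to the feasible set of the
          fixed \<open>t0\<close>, so the one \<open>\<eta>\<close> found there serves all nearby
          \<open>t\<close>. Half of \<open>\<epsilon>\<close> pays for this move, the other half for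
          the distance from \<open>w\<close> to \<open>?a\<close>.\<close>
        obtain w where w: "w \<in> ?F y t0" "dist (xstar y t) w \<le> C * norm (t - t0) powr q\<^sub>\<psi>"
            "\<phi> w y t0 \<le> ?v y t0 + 2 * E (norm (t - t0))"
          using near_opt[OF y elim(3) t0 xstar[OF y elim(3)]] by blast
        have "dist w ?a < \<epsilon> / 2"
          using w(3) elim(1) opt_value_eq[OF xstar[OF y t0]] by (intro \<eta>(2) w(1)) simp
        then show ?case
          using w(2) elim(2) dist_triangle[of "xstar y t" ?a w] by linarith
      qed
    qed
    show ?thesis
      using xstar unique cont_v cont_x by (intro exI[of _ xstar]) blast
  qed

  \<comment> \<open>Part (ii): Hoelder estimate under the growth condition\<close>
  have part2: "hausdorff_distance (?O y t') (?O y t'')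
        \<le> C * norm (t'' - t') powr q\<^sub>\<psi> + K * norm (t' - t'') powr (q / \<nu>)
      \<and> C * norm (t'' - t') powr q\<^sub>\<psi> + K * norm (t' - t'') powr (q / \<nu>)
        \<le> (C + K) * norm (t' - t'') powr (min q\<^sub>\<psi> (q / \<nu>))"
    if "0 < \<nu>" "0 < \<beta>"
      and growth: "\<forall>y\<in>Y. \<forall>t\<in>T. \<forall>x\<in>?F y t. \<phi> x y t \<ge> ?v y t + \<beta> * infdist x (?O y t) powr \<nu>"
      and q: "q = min (q\<^sub>1 * q\<^sub>\<psi>) q\<^sub>2"
      and K: "K = (4 * \<kappa>\<^sub>\<phi> / \<beta> * (C powr q\<^sub>1 + 1)) powr (1 / \<nu>)"
      and y: "y \<in> Y" and t: "t' \<in> T" "t'' \<in> T" and le1: "norm (t' - t'') \<le> 1"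
    for \<nu> \<beta> q K y t' t''
  proof -
    \<comment> \<open>This is where distances of at most 1 enter: lowering an exponent can then only
      increase the power, so different exponents can be replaced by their minimum.\<close>
    have powr_anti: "r powr b \<le> r powr a" if "0 \<le> r" "r \<le> 1" "a \<le> b" for r a b :: real
      using that by (intro powr_mono') auto
    \<comment> \<open>The parameters are quantified afresh, since the Hausdorff distance requires
      the estimate in both directions.\<close>
    have one_side: "infdist x (?O y t'') \<le> C * norm (t' - t'') powr q\<^sub>\<psi> + K * norm (t' - t'') powr (q / \<nu>)"
      if t: "t' \<in> T" "t'' \<in> T" and le1: "norm (t' - t'') \<le> 1" and x: "x \<in> ?O y t'" for x t' t''
    proof -
      let ?r = "norm (t' - t'')"
      obtain w where w: "w \<in> ?F y t''" "dist x w \<le> C * ?r powr q\<^sub>\<psi>"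
          "\<phi> w y t'' \<le> ?v y t'' + 2 * E ?r"
        using near_opt[OF y t x] by blast
      let ?d = "infdist w (?O y t'')"
      have "E ?r \<le> \<kappa>\<^sub>\<phi> * (C powr q\<^sub>1 * ?r powr q + ?r powr q)"
        unfolding E_def q using e_consts le1
        by (intro mult_left_mono add_mono powr_anti) auto
      \<comment> \<open>The estimates give the factor 2; nonnegativity of the bound allows it to be
        enlarged to the 4 in the claim.\<close>
      moreover have "0 \<le> \<kappa>\<^sub>\<phi> * (C powr q\<^sub>1 * ?r powr q + ?r powr q)"
        using e_consts by simp
      \<comment> \<open>The growth condition at \<open>w\<close> meets the
        \<open>2 * E ?r\<close>-optimality of \<open>w\<close>.\<close>
      moreover have "\<beta> * ?d powr \<nu> \<le> 2 * E ?r"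
        using growth y t w by fastforce
      ultimately have "\<beta> * ?d powr \<nu> \<le> 4 * (\<kappa>\<^sub>\<phi> * (C powr q\<^sub>1 * ?r powr q + ?r powr q))"
        by linarith
      then have "?d powr \<nu> \<le> 4 * \<kappa>\<^sub>\<phi> / \<beta> * (C powr q\<^sub>1 + 1) * ?r powr q"
        using \<open>0 < \<beta>\<close> by (simp add: field_simps)
      then have "(?d powr \<nu>) powr (1 / \<nu>)
          \<le> (4 * \<kappa>\<^sub>\<phi> / \<beta> * (C powr q\<^sub>1 + 1) * ?r powr q) powr (1 / \<nu>)"
        using \<open>0 < \<nu>\<close> by (intro powr_mono2) auto
      also have "\<dots> = K * ?r powr (q / \<nu>)"
        unfolding K using \<open>0 < \<beta>\<close> e_consts by (subst powr_mult) (auto simp: powr_powr)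
      finally have "?d \<le> K * ?r powr (q / \<nu>)"
        using \<open>0 < \<nu>\<close> infdist_nonneg[of w "?O y t''"] by (simp add: powr_powr)
      \<comment> \<open>The first summand is the move from \<open>x\<close> to \<open>w\<close>, the
        second the distance from \<open>w\<close> to the solution set.\<close>
      then show ?thesis
        using w(2) infdist_triangle[of x "?O y t''" w] by linarith
    qed
    have "hausdorff_distance (?O y t') (?O y t'')
        \<le> C * norm (t'' - t') powr q\<^sub>\<psi> + K * norm (t' - t'') powr (q / \<nu>)"
      using O_ne y t one_side[of t' t''] one_side[of t'' t'] le1
      by (intro hausdorff_distance_le) (auto simp: norm_minus_commute)
    moreover have "C * norm (t' - t'') powr q\<^sub>\<psi> + K * norm (t' - t'') powr (q / \<nu>)
        \<le> C * norm (t' - t'') powr min q\<^sub>\<psi> (q / \<nu>) + K * norm (t' - t'') powr min q\<^sub>\<psi> (q / \<nu>)"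
      using C0 le1 by (intro add_mono mult_left_mono powr_anti) (auto simp: K)
    ultimately show ?thesis
      by (simp add: norm_minus_commute distrib_right)
  qed

  show ?thesis
    unfolding Let_def C_def[symmetric]
  proof (rule conjI[OF impI[OF part1]], assumption, intro allI impI ballI, goal_cases)
    case (1 \<nu> \<beta> y t' t'')
    show ?case
      \<comment> \<open>The equations for \<open>q\<close> and \<open>K\<close> hold by reflexivity,
        because unfolding \<open>Let\<close> has put their values into the goal.\<close>
      by (rule part2[OF 1(1,2,3) refl refl 1(4-7)])
  qed
qed

end
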